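(* Let $\Omega\subset\mathbb{R}^n$ be compact and convex, $f\in C^1(\Omega)$ with $L$-Lipschitz gradient on $\Omega$ ($L>0$), and let $\mathcal{A}$ be a method satisfying the angle condition $\mathrm{SB}_{\mathcal A}(\Omega)=\tau>0$ and such that the SSC procedure always terminates in a finite number of steps. Let $\{x_k\}$ be generated by the first-order method with SSC. Let $\mu>0$ and $x^*\in\Omega$ be such that, with $f(x^* )$ fixed, $$\pi_x(-\nabla f(x))\ge\sqrt{2\mu}\,(f(x)-f(x^* ))^{1/2}\qquad(\text{in particular } f(x)\ge f(x^* ))$$ for every feasible point $x$ generated by the algorithm (the points $x_k$ and all points $y_j$ generated inside the SSC calls). Let $q=\left(1+\frac{\mu}{L}\frac{\tau^2}{(1+\tau)^2}\right)^{-1}$. Then $f(x_k)\to f(x^* )$ with $$f(x_k)-f(x^* )\le q^k\,(f(x_0)-f(x^* ))\quad\text{for all }k,$$ and $x_k\to\tilde x^*$ with $$\|x_k-\tilde x^*\|\le\frac{\sqrt{2-2q}\,\sqrt{f(x_0)-f(\tilde x^* )}}{\sqrt L\,(1-\sqrt q)}\,q^{k/2}\quad\text{for all }k,$$ for some stationary point $\tilde x^*$ with $f(\tilde x^* )=f(x^* )$.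
   Context: $\|\cdot\|$ is the Euclidean norm, $\hat c=c/\|c\|$ for $c\ne0$ and $\hat0=0$, $\bar B_R(x)$ the closed ball. $f\in C^1(\Omega)$ means continuously differentiable on an open set containing $\Omega$; $\|\nabla f(x)-\nabla f(y)\|\le L\|x-y\|$ for $x,y\in\Omega$. $T_\Omega(x)=\mathrm{cl}\{w:\exists\lambda>0,\ x+\lambda w\in\Omega\}$, $\pi(C,\cdot)$ is the Euclidean projection on a closed convex set $C$, $\pi_x(g)=\|\pi(T_\Omega(x),g)\|$; $x$ is stationary if $\pi_x(-\nabla f(x))=0$. A method $\mathcal{A}$ assigns to every $(x,g)\in\Omega\times\mathbb{R}^n$ a set $\mathcal{A}(x,g)\subset (T_\Omega(x)\cap\{d:\langle g,d\rangle>0\})\cup\{0\}$ of feasible directions at $x$, with $\mathcal{A}(x,g)=\{0\}$ if $\pi_x(g)=0$ and $0\notin\mathcal{A}(x,g)\ne\emptyset$ otherwise. $\mathrm{DSB}_{\mathcal A}(\Omega,x,g)=\inf_{d\in\mathcal{A}(x,g)}\frac{\langle g,d\rangle}{\pi_x(g)\|d\|}$ if $\pi_x(g)\neq0$, and $=1$ otherwise; $\mathrm{SB}_{\mathcal A}(\Omega)=\inf_{x\in\Omega,g\in\mathbb{R}^n}\mathrm{DSB}_{\mathcal A}(\Omega,x,g)$. First-order method with SSC: from $x_0\in\Omega$, while $x_k$ is not stationary set $x_{k+1}=\mathrm{SSC}(x_k,-\nabla f(x_k))$. If some $x_m$ is stationary, the convention is $x_k=x_m$ for all $k\ge m$. Procedure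 $\mathrm{SSC}(\bar x,g)$ (with $g=-\nabla f(\bar x)$): set $y_0=\bar x$, $j=0$. (1) Select $d_j\in\mathcal A(y_j,g)$ and a maximal stepsize $\alpha^{(j)}_{\max}>0$ with $y_j+\alpha d_j\in\Omega$ for $\alpha\in[0,\alpha_{\max}^{(j)}]$. If $d_j=0$, return $y_j$. (2) Let $\Omega_j=\bar B_{\|g\|/(2L)}\!\left(\bar x+\frac{g}{2L}\right)\cap\bar B_{\langle g,\hat d_j\rangle/L}(\bar x)$, and let $\beta_j=0$ if $y_j\notin\Omega_j$, $\beta_j=\max\{\beta\ge0:y_j+\beta d_j\in\Omega_j\}$ if $y_j\in\Omega_j$. Set $\alpha_j=\min(\alpha^{(j)}_{\max},\beta_j)$, $y_{j+1}=y_j+\alpha_jd_j$. If $\alpha_j=\beta_j$, return $y_{j+1}$; otherwise set $j=j+1$ and go to (1). *)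

theory Defs
  imports "HOL-Analysis.Analysis"
begin

definition gradient :: "('a::euclidean_space \<Rightarrow> real) \<Rightarrow> 'a \<Rightarrow> 'a" where
  "gradient f x = (THE D. GDERIV f x :> D)"

(* Only the values of f near \<Omega> matter; f is total because HOL functions are. *)
definition C1_on :: "('a::euclidean_space \<Rightarrow> real) \<Rightarrow> 'a set \<Rightarrow> bool" where
  "C1_on f \<Omega> \<longleftrightarrow> (\<exists>U. open U \<and> \<Omega> \<subseteq> U \<and>
     (\<forall>x\<in>U. GDERIV f x :> gradient f x) \<and> continuous_on U (gradient f))"

definition tangent_cone :: "'a::euclidean_space set \<Rightarrow> 'a \<Rightarrow> 'a set" where
  "tangent_cone \<Omega> x = closure {w. \<exists>s>0. x + s *\<^sub>R w \<in> \<Omega>}"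

(* closest_point C is the Euclidean projection onto a nonempty closed convex set C. *)
definition proj_norm :: "'a::euclidean_space set \<Rightarrow> 'a \<Rightarrow> 'a \<Rightarrow> real" where
  "proj_norm \<Omega> x g = norm (closest_point (tangent_cone \<Omega> x) g)"

definition stationary :: "('a::euclidean_space \<Rightarrow> real) \<Rightarrow> 'a set \<Rightarrow> 'a \<Rightarrow> bool" where
  "stationary f \<Omega> x \<longleftrightarrow> proj_norm \<Omega> x (- gradient f x) = 0"

definition feasible_direction :: "'a::euclidean_space set \<Rightarrow> 'a \<Rightarrow> 'a \<Rightarrow> bool" where
  "feasible_direction \<Omega> x d \<longleftrightarrow> (\<exists>\<alpha>>0. \<forall>t\<in>{0..\<alpha>}. x + t *\<^sub>R d \<in> \<Omega>)"

definition is_method :: "'a::euclidean_space set \<Rightarrow> ('a \<Rightarrow> 'a \<Rightarrow> 'a set) \<Rightarrow> bool" where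
  "is_method \<Omega> A \<longleftrightarrow> (\<forall>x\<in>\<Omega>. \<forall>g.
     A x g \<subseteq> (tangent_cone \<Omega> x \<inter> {d. g \<bullet> d > 0}) \<union> {0} \<and>
     (\<forall>d\<in>A x g. feasible_direction \<Omega> x d) \<and>
     (if proj_norm \<Omega> x g = 0 then A x g = {0} else 0 \<notin> A x g \<and> A x g \<noteq> {}))"

(* For a method, both infima below are over nonempty sets bounded below by 0
   (provided \<Omega> is nonempty), so the infimum on the reals is the genuine one. *)
definition DSB :: "('a::euclidean_space \<Rightarrow> 'a \<Rightarrow> 'a set) \<Rightarrow> 'a set \<Rightarrow> 'a \<Rightarrow> 'a \<Rightarrow> real" where
  "DSB A \<Omega> x g =
     (if proj_norm \<Omega> x g \<noteq> 0 then INF d\<in>A x g. (g \<bullet> d) / (proj_norm \<Omega> x g * norm d) else 1)"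

definition SB :: "('a::euclidean_space \<Rightarrow> 'a \<Rightarrow> 'a set) \<Rightarrow> 'a set \<Rightarrow> real" where
  "SB A \<Omega> = (INF (x, g)\<in>\<Omega> \<times> UNIV. DSB A \<Omega> x g)"

(* The greatest feasible stepsize; it exists for compact \<Omega> and a nonzero feasible direction,
   the only case in which it is used. *)
definition max_stepsize :: "'a::euclidean_space set \<Rightarrow> 'a \<Rightarrow> 'a \<Rightarrow> real" where
  "max_stepsize \<Omega> y d = (GREATEST \<alpha>. \<alpha> > 0 \<and> (\<forall>t\<in>{0..\<alpha>}. y + t *\<^sub>R d \<in> \<Omega>))"

(* Here sgn d is the normalised vector d / norm d, with sgn 0 = 0. *)
definition ssc_region :: "real \<Rightarrow> 'a::euclidean_space \<Rightarrow> 'a \<Rightarrow> 'a \<Rightarrow> 'a set" where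
  "ssc_region L xbar g d =
     cball (xbar + (1 / (2 * L)) *\<^sub>R g) (norm g / (2 * L)) \<inter> cball xbar ((g \<bullet> sgn d) / L)"

definition ssc_beta :: "real \<Rightarrow> 'a::euclidean_space \<Rightarrow> 'a \<Rightarrow> 'a \<Rightarrow> 'a \<Rightarrow> real" where
  "ssc_beta L xbar g y d =
     (if y \<in> ssc_region L xbar g d
      then (GREATEST \<beta>. \<beta> \<ge> 0 \<and> y + \<beta> *\<^sub>R d \<in> ssc_region L xbar g d) else 0)"

definition ssc_alpha ::
  "'a::euclidean_space set \<Rightarrow> real \<Rightarrow> 'a \<Rightarrow> 'a \<Rightarrow> 'a \<Rightarrow> 'a \<Rightarrow> real" where
  "ssc_alpha \<Omega> L xbar g y d = min (max_stepsize \<Omega> y d) (ssc_beta L xbar g y d)"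

(* Iteration j of SSC does not return and produces y (Suc j). *)
definition ssc_continues ::
  "'a::euclidean_space set \<Rightarrow> real \<Rightarrow> ('a \<Rightarrow> 'a \<Rightarrow> 'a set) \<Rightarrow> 'a \<Rightarrow> 'a
     \<Rightarrow> (nat \<Rightarrow> 'a) \<Rightarrow> (nat \<Rightarrow> 'a) \<Rightarrow> nat \<Rightarrow> bool" where
  "ssc_continues \<Omega> L A xbar g y d j \<longleftrightarrow>
     d j \<in> A (y j) g \<and> d j \<noteq> 0 \<and>
     ssc_alpha \<Omega> L xbar g (y j) (d j) \<noteq> ssc_beta L xbar g (y j) (d j) \<and>
     y (Suc j) = y j + ssc_alpha \<Omega> L xbar g (y j) (d j) *\<^sub>R d j"

(* A possible execution of SSC(xbar, g): iterations 0..T, the last of which returns z.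
   The values y j and d j for j > T are irrelevant. *)
definition ssc_run ::
  "'a::euclidean_space set \<Rightarrow> real \<Rightarrow> ('a \<Rightarrow> 'a \<Rightarrow> 'a set) \<Rightarrow> 'a \<Rightarrow> 'a
     \<Rightarrow> (nat \<Rightarrow> 'a) \<Rightarrow> (nat \<Rightarrow> 'a) \<Rightarrow> nat \<Rightarrow> 'a \<Rightarrow> bool" where
  "ssc_run \<Omega> L A xbar g y d T z \<longleftrightarrow>
     y 0 = xbar \<and>
     (\<forall>j<T. ssc_continues \<Omega> L A xbar g y d j) \<and>
     d T \<in> A (y T) g \<and>
     (if d T = 0 then z = y T
      else ssc_alpha \<Omega> L xbar g (y T) (d T) = ssc_beta L xbar g (y T) (d T) \<and>
           z = y T + ssc_alpha \<Omega> L xbar g (y T) (d T) *\<^sub>R d T)"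

(* No choice of directions leads to an infinite execution of SSC(xbar, - gradient f xbar). *)
definition ssc_terminates ::
  "('a::euclidean_space \<Rightarrow> real) \<Rightarrow> 'a set \<Rightarrow> real \<Rightarrow> ('a \<Rightarrow> 'a \<Rightarrow> 'a set) \<Rightarrow> bool" where
  "ssc_terminates f \<Omega> L A \<longleftrightarrow>
     (\<forall>xbar\<in>\<Omega>. \<not> (\<exists>y d. y 0 = xbar \<and>
        (\<forall>j. ssc_continues \<Omega> L A xbar (- gradient f xbar) y d j)))"

(* y k, d k and T k record the SSC call made at x k; they are irrelevant if x k is stationary. *)
definition ssc_method_sequence ::
  "('a::euclidean_space \<Rightarrow> real) \<Rightarrow> 'a set \<Rightarrow> real \<Rightarrow> ('a \<Rightarrow> 'a \<Rightarrow> 'a set)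
     \<Rightarrow> (nat \<Rightarrow> 'a) \<Rightarrow> (nat \<Rightarrow> nat \<Rightarrow> 'a) \<Rightarrow> (nat \<Rightarrow> nat \<Rightarrow> 'a) \<Rightarrow> (nat \<Rightarrow> nat) \<Rightarrow> bool" where
  "ssc_method_sequence f \<Omega> L A x y d T \<longleftrightarrow>
     x 0 \<in> \<Omega> \<and>
     (\<forall>k. if stationary f \<Omega> (x k) then x (Suc k) = x k
          else ssc_run \<Omega> L A (x k) (- gradient f (x k)) (y k) (d k) (T k) (x (Suc k)))"

(* The point returned by an SSC call is one of the x k. *)
definition generated_points ::
  "('a::euclidean_space \<Rightarrow> real) \<Rightarrow> 'a set
     \<Rightarrow> (nat \<Rightarrow> 'a) \<Rightarrow> (nat \<Rightarrow> nat \<Rightarrow> 'a) \<Rightarrow> (nat \<Rightarrow> nat) \<Rightarrow> 'a set" where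
  "generated_points f \<Omega> x y T =
     range x \<union> {y k j |k j. \<not> stationary f \<Omega> (x k) \<and> j \<le> T k}"

end

theory Submission
  imports Defs
begin

text \<open>
  Write \<open>n\<close> for the distance between an iterate \<open>xbar\<close> and the point \<open>z\<close> that the SSC call at \<open>xbar\<close>
  returns, and \<open>g\<close> for the negative gradient at \<open>xbar\<close>. Two estimates carry the proof.

  First, \<open>f\<close> decreases by at least \<open>L / 2 * n\<^sup>2\<close>. One of the two balls in the trust region of the
  procedure is the set of points \<open>p\<close> with \<open>L * (norm (p - xbar))\<^sup>2 \<le> g \<bullet> (p - xbar)\<close>; all inner
  iterates stay in it, and on it the descent lemma gives the claim (\<open>sufficient_decrease\<close>).

  Second, the call does not stop early: some inner iterate \<open>p\<close> has \<open>f z \<le> f p\<close> and projected gradient norm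
  at most \<open>L * (1 + \<tau>) / \<tau> * n\<close> (\<open>good_iterate\<close>). The other ball, of radius \<open>g \<bullet> sgn d / L\<close>, ensures that
  the inner steps do not increase \<open>f\<close>. Let \<open>m\<close> be the smallest slope \<open>g \<bullet> sgn d\<close> among the directions
  used. Every displacement is a nonnegative combination of them and so lies in the convex cone of those \<open>v\<close>
  with \<open>m * norm v \<le> g \<bullet> v\<close>; inside this cone the trust region contains all points within distance \<open>m / L\<close>
  of \<open>xbar\<close>. A call that ends because the trust region blocks it has therefore travelled at least \<open>m / L\<close>
  (\<open>returned_point_distance\<close>). The angle condition at the direction of smallest slope and the Lipschitz
  bound on the gradient then give the second estimate. If the call ends because the projection of \<open>g\<close> vanishes
  at the current point, the Lipschitz bound alone suffices.

  Inserting the growth condition at \<open>p\<close> into the two estimates makes \<open>e k = f (x k) - f xs\<close> contract by the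
  factor \<open>q\<close>. For such a sequence \<open>sqrt (e k - e (Suc k))\<close> is at most a constant times
  \<open>sqrt (e k) - sqrt (e (Suc k))\<close> (\<open>sqrt_diff_le_diff_sqrt\<close>), so the steps telescope, the iterates converge
  and the distance to the limit is bounded with the claimed constant. The limit is stationary because the
  points \<open>p\<close> converge to it with projected gradient norms tending to zero (\<open>stationary_limit\<close>).
\<close>

section \<open>Greatest step sizes along a line\<close>

lemma Greatest_of_compact:
  fixes P :: "real \<Rightarrow> bool"
  assumes "compact {a. c \<le> a \<and> P a}" and "P c"
  shows "P (GREATEST a. P a)" and "\<And>b. P b \<Longrightarrow> b \<le> (GREATEST a. P a)"
proof -
  have "{a. c \<le> a \<and> P a} \<noteq> {}" using assms(2) by auto
  then obtain m where m: "c \<le> m" "P m" "\<And>b. c \<le> b \<Longrightarrow> P b \<Longrightarrow> b \<le> m"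
    using compact_attains_sup[OF assms(1)] by auto
  have ub: "b \<le> m" if "P b" for b
    using m that by (cases "c \<le> b") auto
  have "(GREATEST a. P a) = m"
    using m(2) ub by (rule Greatest_equality)
  then show "P (GREATEST a. P a)" and "\<And>b. P b \<Longrightarrow> b \<le> (GREATEST a. P a)"
    using m(2) ub by auto
qed

lemma compact_line_section:
  fixes S :: "'a::real_normed_vector set"
  assumes "compact S" and "d \<noteq> 0"
  shows "compact {a::real. c \<le> a \<and> y + a *\<^sub>R d \<in> S}"
proof -
  have "closed ((\<lambda>a::real. y + a *\<^sub>R d) -` S)"
    by (intro closed_vimage compact_imp_closed assms continuous_intros)
  then have closed: "closed {a::real. c \<le> a \<and> y + a *\<^sub>R d \<in> S}"
    using closed_Int[OF closed_atLeast[of c]] by (simp add: vimage_def Collect_conj_eq atLeast_def)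
  obtain B where B: "\<And>z. z \<in> S \<Longrightarrow> norm z \<le> B"
    using compact_imp_bounded[OF assms(1)] by (auto simp: bounded_iff)
  have "norm a \<le> (B + norm y) / norm d" if "y + a *\<^sub>R d \<in> S" for a
  proof -
    have "\<bar>a\<bar> * norm d = norm (y + a *\<^sub>R d - y)" by simp
    also have "\<dots> \<le> B + norm y"
      using norm_triangle_ineq4[of "y + a *\<^sub>R d" y] B[OF that] by linarith
    finally show ?thesis using assms(2) by (simp add: field_simps)
  qed
  then have "bounded {a::real. c \<le> a \<and> y + a *\<^sub>R d \<in> S}"
    unfolding bounded_iff by blast
  with closed show ?thesis by (simp add: compact_eq_bounded_closed)
qed

lemma convex_ray_segment:
  assumes "convex S" and "y \<in> S" and "y + b *\<^sub>R d \<in> S" and "0 \<le> t" and "t \<le> b"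
  shows "y + t *\<^sub>R d \<in> S"
proof (cases "b = 0")
  case False
  with assms have "(1 - t / b) *\<^sub>R y + (t / b) *\<^sub>R (y + b *\<^sub>R d) \<in> S"
    by (intro convexD) auto
  also have "(1 - t / b) *\<^sub>R y + (t / b) *\<^sub>R (y + b *\<^sub>R d) = y + t *\<^sub>R d"
    using False by (simp add: algebra_simps)
  finally show ?thesis .
qed (use assms in auto)

lemma max_stepsize_feasible:
  assumes "compact \<Omega>" and "convex \<Omega>" and "d \<noteq> 0" and "feasible_direction \<Omega> y d"
  shows "0 < max_stepsize \<Omega> y d"
    and "\<And>t. 0 \<le> t \<Longrightarrow> t \<le> max_stepsize \<Omega> y d \<Longrightarrow> y + t *\<^sub>R d \<in> \<Omega>"
proof -
  obtain c where c: "0 < c" "\<forall>t\<in>{0..c}. y + t *\<^sub>R d \<in> \<Omega>"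
    using assms(4) by (auto simp: feasible_direction_def)
  then have "y + 0 *\<^sub>R d \<in> \<Omega>" by (metis atLeastAtMost_iff less_eq_real_def order_refl)
  then have y: "y \<in> \<Omega>" by simp
  define P where "P \<alpha> \<longleftrightarrow> \<alpha> > 0 \<and> y + \<alpha> *\<^sub>R d \<in> \<Omega>" for \<alpha>
  have P: "P \<alpha> \<longleftrightarrow> \<alpha> > 0 \<and> (\<forall>t\<in>{0..\<alpha>}. y + t *\<^sub>R d \<in> \<Omega>)" for \<alpha>
    using convex_ray_segment[OF assms(2) y] by (auto simp: P_def)
  have "{\<alpha>. c \<le> \<alpha> \<and> P \<alpha>} = {\<alpha>. c \<le> \<alpha> \<and> y + \<alpha> *\<^sub>R d \<in> \<Omega>}"
    using c(1) by (auto simp: P_def)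
  then have "compact {\<alpha>. c \<le> \<alpha> \<and> P \<alpha>}"
    using compact_line_section[OF assms(1,3)] by simp
  moreover have "P c" using c by (auto simp: P_def)
  ultimately have "P (GREATEST \<alpha>. P \<alpha>)" by (rule Greatest_of_compact)
  moreover have "max_stepsize \<Omega> y d = (GREATEST \<alpha>. P \<alpha>)"
    by (simp add: max_stepsize_def P)
  ultimately have "P (max_stepsize \<Omega> y d)" by simp
  then show "0 < max_stepsize \<Omega> y d"
    and "\<And>t. 0 \<le> t \<Longrightarrow> t \<le> max_stepsize \<Omega> y d \<Longrightarrow> y + t *\<^sub>R d \<in> \<Omega>"
    by (simp_all add: P)
qed

section \<open>The trust region of an SSC step\<close>

lemma mem_ssc_region_iff:
  assumes "L > 0"
  shows "z \<in> ssc_region L xbar g d \<longleftrightarrow>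
    L * (norm (z - xbar))\<^sup>2 \<le> g \<bullet> (z - xbar) \<and> L * norm (z - xbar) \<le> g \<bullet> sgn d"
proof -
  have "z \<in> cball (xbar + (1 / (2 * L)) *\<^sub>R g) (norm g / (2 * L)) \<longleftrightarrow>
      (norm ((z - xbar) - (1 / (2 * L)) *\<^sub>R g))\<^sup>2 \<le> (norm g / (2 * L))\<^sup>2"
    using assms by (simp add: dist_norm norm_minus_commute diff_diff_eq abs_le_square_iff[symmetric])
  also have "(norm ((z - xbar) - (1 / (2 * L)) *\<^sub>R g))\<^sup>2 =
      (norm (z - xbar))\<^sup>2 - (g \<bullet> (z - xbar)) / L + (norm g / (2 * L))\<^sup>2"
    using assms unfolding power2_norm_eq_inner power_divide power_mult_distrib
    by (simp add: inner_diff_left inner_diff_right inner_commute power2_eq_square) (simp add: field_simps)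
  finally have "z \<in> cball (xbar + (1 / (2 * L)) *\<^sub>R g) (norm g / (2 * L)) \<longleftrightarrow>
      L * (norm (z - xbar))\<^sup>2 \<le> g \<bullet> (z - xbar)"
    using assms by (simp add: field_simps)
  moreover have "z \<in> cball xbar ((g \<bullet> sgn d) / L) \<longleftrightarrow> L * norm (z - xbar) \<le> g \<bullet> sgn d"
    using assms by (simp add: dist_norm norm_minus_commute field_simps)
  ultimately show ?thesis by (simp add: ssc_region_def)
qed

lemma convex_ssc_region: "convex (ssc_region L xbar g d)"
  unfolding ssc_region_def by (intro convex_Int convex_cball)

lemma ssc_beta_greatest:
  fixes y :: "'a::euclidean_space"
  assumes "d \<noteq> 0" and "y \<in> ssc_region L xbar g d"
  shows "0 \<le> ssc_beta L xbar g y d"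
    and "y + ssc_beta L xbar g y d *\<^sub>R d \<in> ssc_region L xbar g d"
    and "\<And>b. 0 \<le> b \<Longrightarrow> y + b *\<^sub>R d \<in> ssc_region L xbar g d \<Longrightarrow> b \<le> ssc_beta L xbar g y d"
proof -
  define P where "P b \<longleftrightarrow> b \<ge> 0 \<and> y + b *\<^sub>R d \<in> ssc_region L xbar g d" for b
  have "compact (ssc_region L xbar g d)"
    unfolding ssc_region_def by (intro compact_Int compact_cball)
  then have "compact {b. 0 \<le> b \<and> P b}"
    using compact_line_section[OF _ assms(1)] by (simp add: P_def)
  moreover have "P 0" using assms(2) by (simp add: P_def)
  ultimately have G: "P (GREATEST b. P b)" "\<And>b. P b \<Longrightarrow> b \<le> (GREATEST b. P b)"
    by (rule Greatest_of_compact)+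
  have "ssc_beta L xbar g y d = (GREATEST b. P b)"
    using assms(2) by (simp add: ssc_beta_def P_def)
  with G show "0 \<le> ssc_beta L xbar g y d"
    and "y + ssc_beta L xbar g y d *\<^sub>R d \<in> ssc_region L xbar g d"
    and "\<And>b. 0 \<le> b \<Longrightarrow> y + b *\<^sub>R d \<in> ssc_region L xbar g d \<Longrightarrow> b \<le> ssc_beta L xbar g y d"
    by (simp_all add: P_def)
qed

section \<open>Projection onto the tangent cone\<close>

lemma tangent_cone_properties:
  fixes x :: "'a::euclidean_space"
  assumes "convex \<Omega>" and "x \<in> \<Omega>"
  shows "closed (tangent_cone \<Omega> x)" and "0 \<in> tangent_cone \<Omega> x"
    and "convex (tangent_cone \<Omega> x)" and "cone (tangent_cone \<Omega> x)"
proof -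
  define W where "W = {w. \<exists>s>0. x + s *\<^sub>R w \<in> \<Omega>}"
  have T: "tangent_cone \<Omega> x = closure W" by (simp add: tangent_cone_def W_def)
  have zero: "0 \<in> W" using assms(2) by (auto simp: W_def intro: exI[of _ 1])
  have "u *\<^sub>R v + u' *\<^sub>R w \<in> W"
    if vw: "v \<in> W" "w \<in> W" and "0 \<le> u" "0 \<le> u'" "u + u' = 1" for v w u u'
  proof -
    obtain r s where rs: "0 < r" "x + r *\<^sub>R v \<in> \<Omega>" "0 < s" "x + s *\<^sub>R w \<in> \<Omega>"
      using vw by (auto simp: W_def)
    define m where "m = min r s"
    have m: "0 < m" "m \<le> r" "m \<le> s" using rs by (auto simp: m_def)
    have "x + m *\<^sub>R v \<in> \<Omega>" "x + m *\<^sub>R w \<in> \<Omega>"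
      using convex_ray_segment[OF assms] rs m by auto
    then have "u *\<^sub>R (x + m *\<^sub>R v) + u' *\<^sub>R (x + m *\<^sub>R w) \<in> \<Omega>"
      using that assms(1) by (intro convexD) auto
    also have "u *\<^sub>R (x + m *\<^sub>R v) + u' *\<^sub>R (x + m *\<^sub>R w) = (u + u') *\<^sub>R x + m *\<^sub>R (u *\<^sub>R v + u' *\<^sub>R w)"
      by (simp add: algebra_simps)
    finally show ?thesis using m(1) that(5) by (auto simp: W_def)
  qed
  then have "convex W" by (auto simp: convex_def)
  have "c *\<^sub>R w \<in> W" if w: "w \<in> W" and "0 \<le> c" for c w
  proof (cases "c = 0")
    case False
    obtain s where s: "0 < s" "x + s *\<^sub>R w \<in> \<Omega>" using w by (auto simp: W_def)
    then have "0 < s / c" "x + (s / c) *\<^sub>R (c *\<^sub>R w) \<in> \<Omega>" using False that by auto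
    then show ?thesis unfolding W_def by blast
  qed (use zero in simp)
  then have "cone W" by (auto simp: cone_def)
  show "closed (tangent_cone \<Omega> x)" by (simp add: T)
  show "0 \<in> tangent_cone \<Omega> x" using zero closure_subset by (auto simp: T)
  show "convex (tangent_cone \<Omega> x)" using \<open>convex W\<close> by (simp add: T convex_closure)
  show "cone (tangent_cone \<Omega> x)" using \<open>cone W\<close> by (simp add: T cone_closure)
qed

lemma proj_norm_nonneg: "0 \<le> proj_norm \<Omega> x g"
  by (simp add: proj_norm_def)

lemma proj_norm_triangle:
  fixes x :: "'a::euclidean_space"
  assumes "convex \<Omega>" and "x \<in> \<Omega>"
  shows "proj_norm \<Omega> x h \<le> proj_norm \<Omega> x g + norm (h - g)"
proof -
  note T = tangent_cone_properties[OF assms]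
  have "dist (closest_point (tangent_cone \<Omega> x) h) (closest_point (tangent_cone \<Omega> x) g) \<le> dist h g"
    using T by (intro closest_point_lipschitz) auto
  then show ?thesis
    unfolding proj_norm_def dist_norm
    using norm_triangle_ineq2[of "closest_point (tangent_cone \<Omega> x) h" "closest_point (tangent_cone \<Omega> x) g"]
    by linarith
qed

text \<open>
  With \<open>p\<close> the projection of \<open>g\<close> onto the cone, \<open>p + w\<close> is again in the cone for every \<open>w\<close> in it, so
  the obtuse angle criterion at \<open>p\<close> gives \<open>g \<bullet> w \<le> p \<bullet> w\<close>.
\<close>

lemma inner_le_proj_norm:
  fixes x :: "'a::euclidean_space"
  assumes "convex \<Omega>" and "x \<in> \<Omega>" and "z \<in> \<Omega>"
  shows "g \<bullet> (z - x) \<le> proj_norm \<Omega> x g * norm (z - x)"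
proof -
  note T = tangent_cone_properties[OF assms(1,2)]
  define p where "p = closest_point (tangent_cone \<Omega> x) g"
  have p: "p \<in> tangent_cone \<Omega> x"
    unfolding p_def using T by (intro closest_point_in_set) auto
  have "z - x \<in> {w. \<exists>s>0. x + s *\<^sub>R w \<in> \<Omega>}"
    using assms(3) by (auto intro!: exI[of _ 1])
  then have "z - x \<in> tangent_cone \<Omega> x"
    unfolding tangent_cone_def by (rule subsetD[OF closure_subset])
  then have "p + (z - x) \<in> tangent_cone \<Omega> x"
    using p T convex_cone[of "tangent_cone \<Omega> x"] by blast
  then have "(g - p) \<bullet> (p + (z - x) - p) \<le> 0"
    unfolding p_def using T by (intro closest_point_dot) auto
  then have "g \<bullet> (z - x) \<le> p \<bullet> (z - x)" by (simp add: inner_diff_left)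
  also have "\<dots> \<le> norm p * norm (z - x)" by (rule norm_cauchy_schwarz)
  finally show ?thesis by (simp add: proj_norm_def p_def)
qed

lemma proj_norm_eq_0I:
  fixes x :: "'a::euclidean_space"
  assumes "convex \<Omega>" and "x \<in> \<Omega>" and "\<And>z. z \<in> \<Omega> \<Longrightarrow> g \<bullet> (z - x) \<le> 0"
  shows "proj_norm \<Omega> x g = 0"
proof -
  note T = tangent_cone_properties[OF assms(1,2)]
  have "{w. \<exists>s>0. x + s *\<^sub>R w \<in> \<Omega>} \<subseteq> {w. g \<bullet> w \<le> 0}"
  proof safe
    fix w s assume "0 < (s::real)" "x + s *\<^sub>R w \<in> \<Omega>"
    with assms(3)[of "x + s *\<^sub>R w"] show "g \<bullet> w \<le> 0" by (simp add: mult_le_0_iff)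
  qed
  then have "tangent_cone \<Omega> x \<subseteq> {w. g \<bullet> w \<le> 0}"
    unfolding tangent_cone_def by (intro closure_minimal closed_halfspace_le)
  have "(norm g)\<^sup>2 \<le> (norm (g - w))\<^sup>2" if "w \<in> tangent_cone \<Omega> x" for w
  proof -
    have "g \<bullet> w \<le> 0" using \<open>tangent_cone \<Omega> x \<subseteq> {w. g \<bullet> w \<le> 0}\<close> that by auto
    moreover have "(norm (g - w))\<^sup>2 = (norm g)\<^sup>2 - 2 * (g \<bullet> w) + (norm w)\<^sup>2"
      by (simp add: power2_norm_eq_inner inner_diff_left inner_diff_right inner_commute)
    ultimately show ?thesis using zero_le_power2[of "norm w"] by linarith
  qed
  then have "\<forall>w\<in>tangent_cone \<Omega> x. dist g 0 \<le> dist g w"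
    by (auto simp: dist_norm intro: power2_le_imp_le[OF _ norm_ge_zero])
  then have "0 = closest_point (tangent_cone \<Omega> x) g"
    using T by (intro closest_point_unique)
  then show ?thesis by (simp add: proj_norm_def)
qed

section \<open>The angle condition along a selected direction\<close>

lemma method_slope_nonneg:
  assumes "is_method \<Omega> A" and "x \<in> \<Omega>" and "d \<in> A x g"
  shows "0 \<le> g \<bullet> d"
  using assms unfolding is_method_def by (cases "d = 0") force+

lemma method_zero_direction:
  assumes "is_method \<Omega> A" and "x \<in> \<Omega>" and "0 \<in> A x g"
  shows "proj_norm \<Omega> x g = 0"
proof (rule ccontr)
  assume "proj_norm \<Omega> x g \<noteq> 0"
  then have "0 \<notin> A x g" using assms(1,2) by (simp add: is_method_def)
  with assms(3) show False by simp
qed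

lemma angle_condition:
  assumes "is_method \<Omega> A" and "x \<in> \<Omega>" and "d \<in> A x g"
  shows "SB A \<Omega> * proj_norm \<Omega> x g \<le> g \<bullet> sgn d"
proof (cases "proj_norm \<Omega> x g = 0")
  case True
  then show ?thesis
    using method_slope_nonneg[OF assms] by (simp add: sgn_div_norm)
next
  case False
  have quotient: "0 \<le> (h \<bullet> e) / (proj_norm \<Omega> z h * norm e)" if "z \<in> \<Omega>" "e \<in> A z h" for z h e
    using method_slope_nonneg[OF assms(1) that] by (simp add: proj_norm_nonneg)
  have DSB_nonneg: "0 \<le> DSB A \<Omega> z h" if "z \<in> \<Omega>" for z h
  proof (cases "proj_norm \<Omega> z h = 0")
    case nonstat: False
    then have "A z h \<noteq> {}" using assms(1) that by (auto simp: is_method_def)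
    then show ?thesis using nonstat quotient[OF that] by (auto simp: DSB_def intro!: cINF_greatest)
  qed (simp add: DSB_def)
  have "SB A \<Omega> \<le> (case (x, g) of (x, g) \<Rightarrow> DSB A \<Omega> x g)"
    unfolding SB_def using assms(2) DSB_nonneg by (intro cINF_lower bdd_belowI2[where m = 0]) auto
  also have "\<dots> \<le> (g \<bullet> d) / (proj_norm \<Omega> x g * norm d)"
    using False assms(3) quotient[OF assms(2)]
    by (auto simp: DSB_def intro!: cINF_lower bdd_belowI2[where m = 0])
  finally have "SB A \<Omega> * proj_norm \<Omega> x g \<le> (g \<bullet> d) / (proj_norm \<Omega> x g * norm d) * proj_norm \<Omega> x g"
    by (intro mult_right_mono proj_norm_nonneg)
  also have "\<dots> = g \<bullet> sgn d"
    using False by (simp add: sgn_div_norm divide_inverse)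
  finally show ?thesis .
qed
section \<open>Decrease of the objective\<close>

lemma C1_on_line_derivative:
  assumes "C1_on f \<Omega>" and "x + t *\<^sub>R v \<in> \<Omega>"
  shows "((\<lambda>t. f (x + t *\<^sub>R v)) has_real_derivative gradient f (x + t *\<^sub>R v) \<bullet> v) (at t)"
proof -
  have "(f has_derivative (\<lambda>h. h \<bullet> gradient f (x + t *\<^sub>R v))) (at (x + t *\<^sub>R v))"
    using assms unfolding C1_on_def gderiv_def by blast
  moreover have "((\<lambda>t. x + t *\<^sub>R v) has_derivative (\<lambda>h. h *\<^sub>R v)) (at t)"
    by (auto intro!: derivative_eq_intros)
  ultimately have "((\<lambda>t. f (x + t *\<^sub>R v)) has_derivative (\<lambda>h. h *\<^sub>R v \<bullet> gradient f (x + t *\<^sub>R v))) (at t)"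
    by (rule has_derivative_compose[rotated])
  then show ?thesis
    by (simp add: has_field_derivative_def inner_commute mult_commute_abs)
qed

lemma descent_lemma:
  assumes "convex \<Omega>" and "C1_on f \<Omega>" and "L-lipschitz_on \<Omega> (gradient f)"
    and "x \<in> \<Omega>" and "z \<in> \<Omega>"
  shows "f z \<le> f x + gradient f x \<bullet> (z - x) + L / 2 * (norm (z - x))\<^sup>2"
proof -
  define v where "v = z - x"
  define \<psi> where "\<psi> t = f (x + t *\<^sub>R v) - t * (gradient f x \<bullet> v) - L / 2 * t\<^sup>2 * (norm v)\<^sup>2" for t
  have "\<psi> 1 \<le> \<psi> 0"
  proof (rule DERIV_nonpos_imp_nonincreasing[where f = \<psi>])
    fix t :: real assume t: "0 \<le> t" "t \<le> 1"
    have mem: "x + t *\<^sub>R v \<in> \<Omega>"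
      using convex_ray_segment[OF assms(1,4), of 1 v t] t assms(5) by (simp add: v_def)
    have "(\<psi> has_real_derivative
        gradient f (x + t *\<^sub>R v) \<bullet> v - gradient f x \<bullet> v - L * t * (norm v)\<^sup>2) (at t)"
      unfolding \<psi>_def
      by (rule derivative_eq_intros C1_on_line_derivative[OF assms(2) mem] refl)+ simp
    moreover have "gradient f (x + t *\<^sub>R v) \<bullet> v - gradient f x \<bullet> v \<le> L * t * (norm v)\<^sup>2"
    proof -
      have "(gradient f (x + t *\<^sub>R v) - gradient f x) \<bullet> v
          \<le> norm (gradient f (x + t *\<^sub>R v) - gradient f x) * norm v"
        by (rule norm_cauchy_schwarz)
      also have "\<dots> \<le> (L * norm (x + t *\<^sub>R v - x)) * norm v"
        using lipschitz_onD[OF assms(3) mem assms(4)]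
        by (intro mult_right_mono) (simp_all add: dist_norm)
      finally show ?thesis
        using t by (simp add: inner_diff_left power2_eq_square mult.assoc)
    qed
    ultimately show "\<exists>y. (\<psi> has_real_derivative y) (at t) \<and> y \<le> 0" by force
  qed simp
  then show ?thesis by (simp add: \<psi>_def v_def)
qed

text \<open>
  The ball around \<open>xbar\<close> in the trust region is sized so that the gradient cannot have turned against
  \<open>d\<close> at any point \<open>w\<close> of it: the slope there in the direction \<open>d\<close> differs from \<open>- g \<bullet> d\<close> by at most
  \<open>L * norm (w - xbar) * norm d \<le> g \<bullet> d\<close>.
\<close>

lemma trust_region_step_nonincreasing:
  fixes \<Omega> :: "'a::euclidean_space set"
  assumes "convex \<Omega>" and "C1_on f \<Omega>" and "L-lipschitz_on \<Omega> (gradient f)" and "L > 0"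
    and "xbar \<in> \<Omega>" and g: "g = - gradient f xbar"
    and "0 \<le> a" and "y \<in> \<Omega>" and "y + a *\<^sub>R d \<in> \<Omega>"
    and "y \<in> ssc_region L xbar g d" and "y + a *\<^sub>R d \<in> ssc_region L xbar g d"
  shows "f (y + a *\<^sub>R d) \<le> f y"
proof -
  have "f (y + a *\<^sub>R d) \<le> f (y + 0 *\<^sub>R d)"
  proof (rule DERIV_nonpos_imp_nonincreasing[OF assms(7)])
    fix t assume t: "0 \<le> t" "t \<le> a"
    define w where "w = y + t *\<^sub>R d"
    have mem: "w \<in> \<Omega>" "w \<in> ssc_region L xbar g d"
      unfolding w_def using t assms convex_ray_segment convex_ssc_region by metis+
    have "(gradient f w - gradient f xbar) \<bullet> d \<le> norm (gradient f w - gradient f xbar) * norm d"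
      by (rule norm_cauchy_schwarz)
    also have "\<dots> \<le> (L * norm (w - xbar)) * norm d"
      using lipschitz_onD[OF assms(3) mem(1) assms(5)]
      by (intro mult_right_mono) (simp_all add: dist_norm)
    also have "\<dots> \<le> (g \<bullet> sgn d) * norm d"
      using mem(2) assms(4) by (intro mult_right_mono) (simp_all add: mem_ssc_region_iff)
    also have "\<dots> = g \<bullet> d" by (cases "d = 0") (simp_all add: sgn_div_norm)
    finally have "gradient f w \<bullet> d \<le> 0" by (simp add: g inner_diff_left)
    then show "\<exists>s. ((\<lambda>t. f (y + t *\<^sub>R d)) has_real_derivative s) (at t) \<and> s \<le> 0"
      using C1_on_line_derivative[OF assms(2)] mem(1) unfolding w_def by blast
  qed
  then show ?thesis by simp
qed

text \<open>Membership of the second ball, written as an inequality, turns the descent lemma into sufficient decrease.\<close>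

lemma sufficient_decrease:
  fixes \<Omega> :: "'a::euclidean_space set"
  assumes "convex \<Omega>" and "C1_on f \<Omega>" and "L-lipschitz_on \<Omega> (gradient f)"
    and "xbar \<in> \<Omega>" and "z \<in> \<Omega>"
    and "L * (norm (z - xbar))\<^sup>2 \<le> - gradient f xbar \<bullet> (z - xbar)"
  shows "L / 2 * (norm (z - xbar))\<^sup>2 \<le> f xbar - f z"
  using descent_lemma[OF assms(1-5)] assms(6) by simp

section \<open>One call of the SSC procedure\<close>

text \<open>
  For \<open>m \<ge> 0\<close> the vectors \<open>v\<close> with \<open>m * norm v \<le> g \<bullet> v\<close> form a convex cone. It contains every
  direction whose slope is at least \<open>m\<close>, hence every displacement built from such directions.
\<close>

lemma slope_cone_add:
  fixes g :: "'a::real_inner"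
  assumes "0 \<le> m" and "m * norm v \<le> g \<bullet> v" and "m \<le> g \<bullet> sgn d" and "0 \<le> a"
  shows "m * norm (v + a *\<^sub>R d) \<le> g \<bullet> (v + a *\<^sub>R d)"
proof -
  have "m * norm (v + a *\<^sub>R d) \<le> m * norm v + m * (a * norm d)"
    using mult_left_mono[OF norm_triangle_ineq[of v "a *\<^sub>R d"] assms(1)] assms(4)
    by (simp add: algebra_simps)
  also have "m * (a * norm d) \<le> (g \<bullet> sgn d) * (a * norm d)"
    using assms by (intro mult_right_mono) auto
  also have "(g \<bullet> sgn d) * (a * norm d) = a * (g \<bullet> d)"
    by (cases "d = 0") (simp_all add: sgn_div_norm)
  finally show ?thesis using assms(2) by (simp add: inner_add_right)
qed

text \<open>
  Inside the slope cone a short displacement stays in the trust region: of the two constraints, the one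
  coming from the descent lemma then follows from the bound \<open>m / L\<close> on the length.
\<close>

lemma slope_cone_in_ssc_region:
  assumes "L > 0" and "m * norm v \<le> g \<bullet> v" and "m \<le> g \<bullet> sgn d" and "L * norm v \<le> m"
  shows "xbar + v \<in> ssc_region L xbar g d"
proof -
  have "L * (norm v)\<^sup>2 \<le> m * norm v"
    using mult_right_mono[OF assms(4), of "norm v"] by (simp add: power2_eq_square mult.assoc)
  then show ?thesis using assms by (simp add: mem_ssc_region_iff)
qed

locale ssc_call =
  fixes \<Omega> :: "'a::euclidean_space set" and f :: "'a \<Rightarrow> real" and L :: real
    and A :: "'a \<Rightarrow> 'a \<Rightarrow> 'a set" and xbar g :: 'a
    and y d :: "nat \<Rightarrow> 'a" and T :: nat and z :: 'a
  assumes compact: "compact \<Omega>" and convex: "convex \<Omega>"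
    and C1: "C1_on f \<Omega>" and L_pos: "L > 0" and lipschitz: "L-lipschitz_on \<Omega> (gradient f)"
    and is_method: "is_method \<Omega> A"
    and xbar: "xbar \<in> \<Omega>" and g: "g = - gradient f xbar"
    and run: "ssc_run \<Omega> L A xbar g y d T z"
begin

lemma direction: "j \<le> T \<Longrightarrow> d j \<in> A (y j) g"
  and direction_nonzero: "j < T \<Longrightarrow> d j \<noteq> 0"
  and start: "y 0 = xbar"
  and next_point: "j < T \<Longrightarrow> y (Suc j) = y j + ssc_alpha \<Omega> L xbar g (y j) (d j) *\<^sub>R d j"
  and alpha_neq_beta: "j < T \<Longrightarrow> ssc_alpha \<Omega> L xbar g (y j) (d j) \<noteq> ssc_beta L xbar g (y j) (d j)"
  using run by (auto simp: ssc_run_def ssc_continues_def le_less)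

text \<open>
  A step that starts outside the trust region has length zero; one that starts inside ends inside, and in
  both cases the objective does not increase.
\<close>

lemma step:
  assumes "p \<in> \<Omega>" and "e \<in> A p g" and "e \<noteq> 0"
    and "L * (norm (p - xbar))\<^sup>2 \<le> g \<bullet> (p - xbar)"
  defines "a \<equiv> ssc_alpha \<Omega> L xbar g p e"
  shows "0 \<le> a" and "p + a *\<^sub>R e \<in> \<Omega>" and "f (p + a *\<^sub>R e) \<le> f p"
    and "L * (norm (p + a *\<^sub>R e - xbar))\<^sup>2 \<le> g \<bullet> (p + a *\<^sub>R e - xbar)"
    and "p \<notin> ssc_region L xbar g e \<Longrightarrow> a = 0 \<and> ssc_beta L xbar g p e = 0"
proof -
  have "feasible_direction \<Omega> p e"
    using is_method assms(1,2) by (auto simp: is_method_def)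
  note max = max_stepsize_feasible[OF compact convex assms(3) this]
  show outside: "p \<notin> ssc_region L xbar g e \<Longrightarrow> a = 0 \<and> ssc_beta L xbar g p e = 0"
    using max(1) by (simp add: a_def ssc_alpha_def ssc_beta_def)
  have inside: "p + a *\<^sub>R e \<in> ssc_region L xbar g e" "0 \<le> a" if p: "p \<in> ssc_region L xbar g e"
  proof -
    note beta = ssc_beta_greatest[OF assms(3) p]
    show "0 \<le> a" using beta(1) max(1) by (simp add: a_def ssc_alpha_def)
    show "p + a *\<^sub>R e \<in> ssc_region L xbar g e"
      by (rule convex_ray_segment[OF convex_ssc_region p beta(2) \<open>0 \<le> a\<close>])
        (simp add: a_def ssc_alpha_def)
  qed
  show a: "0 \<le> a" using inside(2) outside by fastforce
  show mem: "p + a *\<^sub>R e \<in> \<Omega>"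
    using max(2)[OF a] by (simp add: a_def ssc_alpha_def)
  show "f (p + a *\<^sub>R e) \<le> f p"
  proof (cases "p \<in> ssc_region L xbar g e")
    case True
    from trust_region_step_nonincreasing[OF convex C1 lipschitz L_pos xbar g a assms(1) mem True inside(1)[OF True]]
    show ?thesis .
  qed (simp add: outside)
  show "L * (norm (p + a *\<^sub>R e - xbar))\<^sup>2 \<le> g \<bullet> (p + a *\<^sub>R e - xbar)"
  proof (cases "p \<in> ssc_region L xbar g e")
    case True
    from inside(1)[OF True] show ?thesis by (simp add: mem_ssc_region_iff L_pos)
  qed (simp add: outside assms(4))
qed

lemma iterates:
  "j \<le> T \<Longrightarrow> y j \<in> \<Omega> \<and> L * (norm (y j - xbar))\<^sup>2 \<le> g \<bullet> (y j - xbar) \<and> (\<forall>i\<le>j. f (y j) \<le> f (y i))"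
proof (induction j)
  case 0
  then show ?case using xbar by (simp add: start)
next
  case (Suc j)
  then have IH: "y j \<in> \<Omega>" "L * (norm (y j - xbar))\<^sup>2 \<le> g \<bullet> (y j - xbar)" "\<forall>i\<le>j. f (y j) \<le> f (y i)"
    and j: "j < T" by auto
  note step = step[OF IH(1) direction[OF less_imp_le[OF j]] direction_nonzero[OF j] IH(2)]
  have "\<forall>i\<le>Suc j. f (y (Suc j)) \<le> f (y i)"
    using IH(3) step(3) by (auto simp: le_Suc_eq next_point[OF j] intro: order_trans)
  then show ?case using step(2,4) by (simp add: next_point[OF j])
qed

lemma continuing_iterate_in_region: "j < T \<Longrightarrow> y j \<in> ssc_region L xbar g (d j)"
  using iterates[of j] step(5)[of "y j" "d j"] direction direction_nonzero alpha_neq_beta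
  by fastforce

lemma displacement_in_slope_cone:
  assumes "0 \<le> m" and "\<And>i. i < j \<Longrightarrow> m \<le> g \<bullet> sgn (d i)" and "j \<le> T"
  shows "m * norm (y j - xbar) \<le> g \<bullet> (y j - xbar)"
  using assms(2,3)
proof (induction j)
  case 0
  then show ?case by (simp add: start)
next
  case (Suc j)
  then have j: "j < T" and IH: "m * norm (y j - xbar) \<le> g \<bullet> (y j - xbar)" by auto
  have "0 \<le> ssc_alpha \<Omega> L xbar g (y j) (d j)"
    using iterates[of j] j by (intro step(1)) (auto simp: direction direction_nonzero)
  from slope_cone_add[OF assms(1) IH _ this, of "d j"] Suc.prems
  show ?case by (simp add: next_point[OF j] algebra_simps)
qed

lemma returned_point:
  shows "z \<in> \<Omega>" and "L * (norm (z - xbar))\<^sup>2 \<le> g \<bullet> (z - xbar)" and "\<And>i. i \<le> T \<Longrightarrow> f z \<le> f (y i)"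
proof -
  have last: "y T \<in> \<Omega>" "L * (norm (y T - xbar))\<^sup>2 \<le> g \<bullet> (y T - xbar)" "\<forall>i\<le>T. f (y T) \<le> f (y i)"
    using iterates[of T] by auto
  have "z \<in> \<Omega> \<and> L * (norm (z - xbar))\<^sup>2 \<le> g \<bullet> (z - xbar) \<and> f z \<le> f (y T)"
  proof (cases "d T = 0")
    case True
    then show ?thesis using run last by (simp add: ssc_run_def)
  next
    case False
    then have "z = y T + ssc_alpha \<Omega> L xbar g (y T) (d T) *\<^sub>R d T"
      using run by (simp add: ssc_run_def)
    with step[OF last(1) direction[OF order_refl] False last(2)] show ?thesis by simp
  qed
  with last(3) show "z \<in> \<Omega>" and "L * (norm (z - xbar))\<^sup>2 \<le> g \<bullet> (z - xbar)"
    and "\<And>i. i \<le> T \<Longrightarrow> f z \<le> f (y i)" by (auto intro: order_trans)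
qed

text \<open>
  The call leaves along a nonzero direction only because the trust region blocks it. If the returned point
  were closer to \<open>xbar\<close> than \<open>m / L\<close>, a slightly longer last step would still lie in the slope cone and
  within distance \<open>m / L\<close>, hence in the trust region, contradicting the choice of the step size.
\<close>

lemma returned_point_distance:
  assumes "d T \<noteq> 0" and "0 \<le> m" and "\<And>i. i \<le> T \<Longrightarrow> m \<le> g \<bullet> sgn (d i)"
  shows "m \<le> L * norm (z - xbar)"
proof (rule ccontr)
  assume "\<not> m \<le> L * norm (z - xbar)"
  then have short: "norm (z - xbar) < m / L" using L_pos by (simp add: field_simps)
  define a where "a = ssc_alpha \<Omega> L xbar g (y T) (d T)"
  have beta: "ssc_beta L xbar g (y T) (d T) = a" and z: "z = y T + a *\<^sub>R d T"
    using run assms(1) by (auto simp: ssc_run_def a_def)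
  have last: "y T \<in> \<Omega>" "L * (norm (y T - xbar))\<^sup>2 \<le> g \<bullet> (y T - xbar)"
    using iterates[of T] by auto
  note step_T = step[OF last(1) direction[OF order_refl] assms(1) last(2), folded a_def]
  have "m * norm (y T - xbar) \<le> g \<bullet> (y T - xbar)"
    using assms by (intro displacement_in_slope_cone) auto
  from slope_cone_add[OF assms(2) this assms(3)[OF order_refl] step_T(1)]
  have cone: "m * norm (z - xbar) \<le> g \<bullet> (z - xbar)" by (simp add: z algebra_simps)
  have extend: "z + t *\<^sub>R d T \<in> ssc_region L xbar g (d T)"
    if "0 \<le> t" "norm (z - xbar) + t * norm (d T) \<le> m / L" for t
  proof -
    have "norm (z - xbar + t *\<^sub>R d T) \<le> m / L"
      using norm_triangle_ineq[of "z - xbar" "t *\<^sub>R d T"] that by simp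
    then have "L * norm (z - xbar + t *\<^sub>R d T) \<le> m" using L_pos by (simp add: field_simps)
    from slope_cone_in_ssc_region[OF L_pos slope_cone_add[OF assms(2) cone assms(3)[OF order_refl] that(1)]
        assms(3)[OF order_refl] this, of xbar]
    show ?thesis by simp
  qed
  define t where "t = (m / L - norm (z - xbar)) / norm (d T)"
  have t: "0 < t" "norm (z - xbar) + t * norm (d T) \<le> m / L"
    using short assms(1) by (simp_all add: t_def)
  show False
  proof (cases "y T \<in> ssc_region L xbar g (d T)")
    case True
    have "y T + (a + t) *\<^sub>R d T \<in> ssc_region L xbar g (d T)"
      using extend[of t] t by (simp add: z algebra_simps)
    then have "a + t \<le> a"
      using ssc_beta_greatest(3)[OF assms(1) True, of "a + t"] step_T(1) t(1) by (simp add: beta)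
    with t(1) show False by simp
  next
    case False
    then have "z = y T" using step_T(5) z by simp
    with extend[of 0] short False show False by simp
  qed
qed

text \<open>
  If the call ends with a zero direction, the projection of \<open>g\<close> at the returned point vanishes and that
  point serves. Otherwise the witness is an iterate at which the slope \<open>m\<close> of the selected direction is smallest. There the angle
  condition bounds the projected norm of \<open>g\<close> by \<open>m / \<tau>\<close>, replacing \<open>g\<close> by the negative gradient at that
  iterate costs at most \<open>L\<close> times its distance from \<open>xbar\<close>, and both quantities are controlled by
  the distance of the returned point.
\<close>

lemma good_iterate:
  assumes "SB A \<Omega> = \<tau>" and "\<tau> > 0"
  obtains j where "j \<le> T" and "y j \<in> \<Omega>" and "f z \<le> f (y j)"
    and "norm (y j - xbar) \<le> norm (z - xbar)"
    and "\<tau> / (L * (1 + \<tau>)) * proj_norm \<Omega> (y j) (- gradient f (y j)) \<le> norm (z - xbar)"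
proof -
  have perturb: "proj_norm \<Omega> p (- gradient f p) \<le> proj_norm \<Omega> p g + L * norm (p - xbar)"
    if "p \<in> \<Omega>" for p
    using proj_norm_triangle[OF convex that, of "- gradient f p" g]
      lipschitz_onD[OF lipschitz that xbar]
    by (simp add: g dist_norm norm_minus_commute)
  have "\<exists>j\<le>T. norm (y j - xbar) \<le> norm (z - xbar) \<and> \<tau> * proj_norm \<Omega> (y j) g \<le> L * norm (z - xbar)"
  proof (cases "d T = 0")
    case True
    then have "z = y T" "0 \<in> A (y T) g"
      using run by (simp_all add: ssc_run_def)
    moreover from this(2) have "proj_norm \<Omega> (y T) g = 0"
      using method_zero_direction[OF is_method] iterates[of T] by blast
    ultimately show ?thesis using L_pos by (intro exI[of _ T]) simp
  next
    case False
    define m where "m = Min ((\<lambda>i. g \<bullet> sgn (d i)) ` {..T})"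
    have "m \<in> (\<lambda>i. g \<bullet> sgn (d i)) ` {..T}" unfolding m_def by (intro Min_in) auto
    then obtain j where j: "j \<le> T" "m = g \<bullet> sgn (d j)" by auto
    have min: "m \<le> g \<bullet> sgn (d i)" if "i \<le> T" for i
      unfolding m_def using that by (intro Min_le) auto
    have angle: "\<tau> * proj_norm \<Omega> (y j) g \<le> m"
      using angle_condition[OF is_method _ direction[OF j(1)]] iterates[OF j(1)] assms(1) j(2) by simp
    then have "0 \<le> m" using assms(2) proj_norm_nonneg[of \<Omega> "y j" g]
      by (meson less_imp_le mult_nonneg_nonneg order_trans)
    then have far: "m \<le> L * norm (z - xbar)"
      using returned_point_distance[OF False] min by blast
    have "norm (y j - xbar) \<le> norm (z - xbar)"
    proof (cases "y j \<in> ssc_region L xbar g (d j)")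
      case True
      then have "L * norm (y j - xbar) \<le> L * norm (z - xbar)"
        using far unfolding j(2) mem_ssc_region_iff[OF L_pos] by linarith
      then show ?thesis using L_pos by simp
    next
      case outside: False
      then have "j = T" using continuing_iterate_in_region j(1) by (metis le_neq_implies_less)
      moreover from this have "z = y T"
        using step(5)[of "y T" "d T"] iterates[of T] direction[of T] False outside run
        by (simp add: ssc_run_def)
      ultimately show ?thesis by simp
    qed
    with angle far j(1) show ?thesis by (meson order_trans)
  qed
  then obtain j where j: "j \<le> T" "norm (y j - xbar) \<le> norm (z - xbar)"
    "\<tau> * proj_norm \<Omega> (y j) g \<le> L * norm (z - xbar)" by blast
  have mem: "y j \<in> \<Omega>" using iterates[OF j(1)] by simp
  have "L * norm (y j - xbar) \<le> L * norm (z - xbar)" using j(2) L_pos by simp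
  with perturb[OF mem] have "proj_norm \<Omega> (y j) (- gradient f (y j)) \<le> proj_norm \<Omega> (y j) g + L * norm (z - xbar)"
    by linarith
  then have "\<tau> * proj_norm \<Omega> (y j) (- gradient f (y j))
      \<le> \<tau> * (proj_norm \<Omega> (y j) g + L * norm (z - xbar))"
    using assms(2) by (intro mult_left_mono) auto
  also have "\<dots> \<le> norm (z - xbar) * (L * (1 + \<tau>))"
    using j(3) by (simp add: algebra_simps)
  finally have "\<tau> / (L * (1 + \<tau>)) * proj_norm \<Omega> (y j) (- gradient f (y j)) \<le> norm (z - xbar)"
    using L_pos assms(2) by (simp add: pos_divide_le_eq)
  with j mem returned_point(3) that show thesis by blast
qed

lemma decrease: "L / 2 * (norm (z - xbar))\<^sup>2 \<le> f xbar - f z"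
  using sufficient_decrease[OF convex C1 lipschitz xbar returned_point(1)] returned_point(2)
  by (simp add: g)

end

section \<open>Convergence of the method\<close>

text \<open>
  One step of the method. For a stationary iterate, which the method repeats, the witness is the iterate
  itself; otherwise it is the iterate found inside the SSC call.
\<close>

lemma method_step:
  fixes \<Omega> :: "'a::euclidean_space set"
  assumes "compact \<Omega>" and "convex \<Omega>" and "C1_on f \<Omega>" and "L > 0"
    and "L-lipschitz_on \<Omega> (gradient f)" and "is_method \<Omega> A" and "SB A \<Omega> = \<tau>" and "\<tau> > 0"
    and "ssc_method_sequence f \<Omega> L A x y d T" and "x k \<in> \<Omega>"
  obtains p where "x (Suc k) \<in> \<Omega>"
    and "L / 2 * (norm (x (Suc k) - x k))\<^sup>2 \<le> f (x k) - f (x (Suc k))"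
    and "p \<in> \<Omega>" and "p \<in> generated_points f \<Omega> x y T" and "f (x (Suc k)) \<le> f p"
    and "norm (p - x k) \<le> norm (x (Suc k) - x k)"
    and "\<tau> / (L * (1 + \<tau>)) * proj_norm \<Omega> p (- gradient f p) \<le> norm (x (Suc k) - x k)"
proof (cases "stationary f \<Omega> (x k)")
  case True
  then have "x (Suc k) = x k" using assms(9) by (simp add: ssc_method_sequence_def)
  with True assms(10) that[of "x k"] show thesis
    by (simp add: generated_points_def stationary_def)
next
  case False
  then have "ssc_run \<Omega> L A (x k) (- gradient f (x k)) (y k) (d k) (T k) (x (Suc k))"
    using assms(9) by (simp add: ssc_method_sequence_def)
  then interpret ssc_call \<Omega> f L A "x k" "- gradient f (x k)" "y k" "d k" "T k" "x (Suc k)"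
    using assms by unfold_locales auto
  obtain j where "j \<le> T k" "y k j \<in> \<Omega>" "f (x (Suc k)) \<le> f (y k j)"
    "norm (y k j - x k) \<le> norm (x (Suc k) - x k)"
    "\<tau> / (L * (1 + \<tau>)) * proj_norm \<Omega> (y k j) (- gradient f (y k j)) \<le> norm (x (Suc k) - x k)"
    using good_iterate[OF assms(7,8)] by blast
  moreover from this(1) False have "y k j \<in> generated_points f \<Omega> x y T"
    by (auto simp: generated_points_def)
  ultimately show thesis using that returned_point(1) decrease by blast
qed

text \<open>
  With \<open>b = r\<^sup>2 * a\<close> the quotient of the two sides' square roots is \<open>sqrt ((1 + r) / (1 - r))\<close>, which increases
  with \<open>r\<close>; so the worst case is \<open>r = sqrt q\<close>.
\<close>

lemma sqrt_diff_le_diff_sqrt: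
  fixes a b q :: real
  assumes "0 \<le> b" and "b \<le> q * a" and "0 \<le> q" and "q < 1" and "0 \<le> a"
  shows "sqrt (a - b) \<le> sqrt (1 - q) / (1 - sqrt q) * (sqrt a - sqrt b)"
proof -
  define r s u where "r = sqrt q" and "s = sqrt a" and "u = sqrt b"
  have r: "0 \<le> r" "r < 1" "q = r\<^sup>2" using assms by (auto simp: r_def)
  have nonneg: "0 \<le> s" "0 \<le> u" and sq: "a = s\<^sup>2" "b = u\<^sup>2" using assms by (auto simp: s_def u_def)
  have "u \<le> r * s"
    unfolding u_def r_def s_def using assms(2) by (simp add: real_sqrt_mult[symmetric])
  moreover have "r * s \<le> s" using r nonneg by (simp add: mult_left_le_one_le)
  ultimately have le: "u \<le> s" and key: "(s + u) * (1 - r) \<le> (1 + r) * (s - u)"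
    by (auto simp: algebra_simps)
  have "sqrt (a - b) * (1 - r) = sqrt ((s\<^sup>2 - u\<^sup>2) * (1 - r)\<^sup>2)"
    using r by (simp add: real_sqrt_mult sq)
  also have "(s\<^sup>2 - u\<^sup>2) * (1 - r)\<^sup>2 = ((s + u) * (1 - r)) * ((s - u) * (1 - r))"
    by (simp add: power2_eq_square algebra_simps)
  also have "sqrt \<dots> \<le> sqrt (((1 + r) * (s - u)) * ((s - u) * (1 - r)))"
    using key le r by (intro real_sqrt_le_mono mult_right_mono) auto
  also have "((1 + r) * (s - u)) * ((s - u) * (1 - r)) = (1 - q) * (s - u)\<^sup>2"
    by (simp add: r power2_eq_square algebra_simps)
  also have "sqrt \<dots> = sqrt (1 - q) * (s - u)"
    using le by (simp add: real_sqrt_mult)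
  finally show ?thesis
    using r by (simp add: pos_le_divide_eq flip: r_def s_def u_def)
qed

lemma converges_of_telescoping_steps:
  fixes x :: "nat \<Rightarrow> 'a::banach"
  assumes "0 \<le> C" and "\<And>k. norm (x (Suc k) - x k) \<le> C * (h k - h (Suc k))"
    and "\<And>k. 0 \<le> h k" and "h \<longlonglongrightarrow> 0"
  obtains l where "x \<longlonglongrightarrow> l" and "\<And>k. norm (x k - l) \<le> C * h k"
proof -
  have telescope: "norm (x n - x k) \<le> C * (h k - h n)" if "k \<le> n" for k n
    using that
  proof (induction n rule: dec_induct)
    case (step n)
    then show ?case
      using norm_triangle_ineq[of "x (Suc n) - x n" "x n - x k"] assms(2)[of n]
      by (simp add: algebra_simps)
  qed simp
  have bound: "norm (x n - x k) \<le> C * h k" if "k \<le> n" for k n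
    using telescope[OF that] mult_nonneg_nonneg[OF assms(1,3), of n] by (simp add: algebra_simps)
  have "Cauchy x"
  proof (rule CauchyI')
    fix e :: real assume e: "0 < e"
    have "(\<lambda>k. C * h k) \<longlonglongrightarrow> 0" using tendsto_mult_right_zero[OF assms(4)] .
    from order_tendstoD(2)[OF this e]
    obtain N where N: "\<And>k. N \<le> k \<Longrightarrow> C * h k < e"
      by (auto simp: eventually_sequentially)
    show "\<exists>M. \<forall>m\<ge>M. \<forall>n>m. dist (x m) (x n) < e"
      unfolding dist_norm using N bound by (metis less_imp_le norm_minus_commute order_le_less_trans)
  qed
  then obtain l where l: "x \<longlonglongrightarrow> l" using Cauchy_convergent convergent_def by blast
  have "norm (x k - l) \<le> C * h k" for k
  proof (rule Lim_bounded)
    show "(\<lambda>n. norm (x k - x n)) \<longlonglongrightarrow> norm (x k - l)" by (intro tendsto_intros l)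
    show "\<forall>n\<ge>k. norm (x k - x n) \<le> C * h k" using bound by (auto simp: norm_minus_commute[of "x k"])
  qed
  with l that show thesis by blast
qed

text \<open>
  The projected norm need not be continuous in the base point, since the tangent cone jumps. The
  variational inequality that it controls does pass to the limit.
\<close>

lemma stationary_limit:
  fixes \<Omega> :: "'a::euclidean_space set"
  assumes "convex \<Omega>" and "continuous_on \<Omega> (gradient f)"
    and "\<And>k. p k \<in> \<Omega>" and "p \<longlonglongrightarrow> l" and "l \<in> \<Omega>"
    and "(\<lambda>k. proj_norm \<Omega> (p k) (- gradient f (p k))) \<longlonglongrightarrow> 0"
  shows "stationary f \<Omega> l"
  unfolding stationary_def
proof (rule proj_norm_eq_0I[OF assms(1,5)])
  fix z assume z: "z \<in> \<Omega>"
  have "(\<lambda>k. gradient f (p k)) \<longlonglongrightarrow> gradient f l"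
    using assms by (intro continuous_on_tendsto_compose[OF assms(2)]) auto
  then have "(\<lambda>k. - gradient f (p k) \<bullet> (z - p k)) \<longlonglongrightarrow> - gradient f l \<bullet> (z - l)"
    by (intro tendsto_intros assms(4))
  moreover have "(\<lambda>k. proj_norm \<Omega> (p k) (- gradient f (p k)) * norm (z - p k)) \<longlonglongrightarrow> 0 * norm (z - l)"
    by (intro tendsto_intros assms(4,6))
  moreover have "- gradient f (p k) \<bullet> (z - p k) \<le> proj_norm \<Omega> (p k) (- gradient f (p k)) * norm (z - p k)" for k
    by (rule inner_le_proj_norm[OF assms(1,3) z])
  ultimately have "- gradient f l \<bullet> (z - l) \<le> 0 * norm (z - l)"
    by (intro LIMSEQ_le) auto
  then show "- gradient f l \<bullet> (z - l) \<le> 0" by simp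
qed

theorem lemma4p3:
  fixes \<Omega> :: "(real ^ 'n) set"
    and f :: "real ^ 'n \<Rightarrow> real"
    and A :: "real ^ 'n \<Rightarrow> real ^ 'n \<Rightarrow> (real ^ 'n) set"
    and L \<tau> \<mu> q :: real
    and x :: "nat \<Rightarrow> real ^ 'n"
    and y d :: "nat \<Rightarrow> nat \<Rightarrow> real ^ 'n"
    and T :: "nat \<Rightarrow> nat"
    and xs :: "real ^ 'n"
  assumes "compact \<Omega>" and "convex \<Omega>"
    and "C1_on f \<Omega>" and "L > 0" and "L-lipschitz_on \<Omega> (gradient f)"
    and "is_method \<Omega> A"
    and "SB A \<Omega> = \<tau>" and "\<tau> > 0"
    and "ssc_terminates f \<Omega> L A"
    and "ssc_method_sequence f \<Omega> L A x y d T"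
    and "\<mu> > 0" and "xs \<in> \<Omega>"
    and "\<And>p. p \<in> generated_points f \<Omega> x y T \<Longrightarrow>
           f p \<ge> f xs \<and> proj_norm \<Omega> p (- gradient f p) \<ge> sqrt (2 * \<mu>) * sqrt (f p - f xs)"
    and "q = inverse (1 + \<mu> / L * (\<tau>\<^sup>2 / (1 + \<tau>)\<^sup>2))"
  shows "(\<lambda>k. f (x k)) \<longlonglongrightarrow> f xs \<and>
         (\<forall>k. f (x k) - f xs \<le> q ^ k * (f (x 0) - f xs)) \<and>
         (\<exists>xt\<in>\<Omega>. stationary f \<Omega> xt \<and> f xt = f xs \<and> x \<longlonglongrightarrow> xt \<and>
           (\<forall>k. norm (x k - xt) \<le>
              sqrt (2 - 2 * q) * sqrt (f (x 0) - f xt) / (sqrt L * (1 - sqrt q)) * q powr (real k / 2)))"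
proof -
  note step_assms = assms(1-8) assms(10)
  note growth = assms(13)
  have \<Omega>: "x k \<in> \<Omega>" for k
  proof (induction k)
    case 0
    then show ?case using assms(10) by (simp add: ssc_method_sequence_def)
  next
    case (Suc k)
    show ?case by (rule method_step[OF step_assms Suc.IH])
  qed
  define K where "K = \<tau> / (L * (1 + \<tau>))"
  define n where "n k = norm (x (Suc k) - x k)" for k
  define e where "e k = f (x k) - f xs" for k
  have "\<exists>p. L / 2 * (n k)\<^sup>2 \<le> e k - e (Suc k) \<and> p \<in> \<Omega> \<and> p \<in> generated_points f \<Omega> x y T \<and>
      f (x (Suc k)) \<le> f p \<and> norm (p - x k) \<le> n k \<and> K * proj_norm \<Omega> p (- gradient f p) \<le> n k" for k
    by (rule method_step[OF step_assms \<Omega>[of k]]) (auto simp: n_def K_def e_def)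
  then obtain p where "\<forall>k. L / 2 * (n k)\<^sup>2 \<le> e k - e (Suc k) \<and> p k \<in> \<Omega> \<and> p k \<in> generated_points f \<Omega> x y T \<and>
      f (x (Suc k)) \<le> f (p k) \<and> norm (p k - x k) \<le> n k \<and> K * proj_norm \<Omega> (p k) (- gradient f (p k)) \<le> n k"
    by metis
  then have p: "L / 2 * (n k)\<^sup>2 \<le> e k - e (Suc k)" "p k \<in> \<Omega>"
      "p k \<in> generated_points f \<Omega> x y T" "f (x (Suc k)) \<le> f (p k)"
      "norm (p k - x k) \<le> n k" "K * proj_norm \<Omega> (p k) (- gradient f (p k)) \<le> n k" for k
    by blast+
  have K: "0 < K" using assms(4,8) by (simp add: K_def)
  have e_nonneg: "0 \<le> e k" for k
    using growth[of "x k"] by (simp add: e_def generated_points_def)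

  define c where "c = \<mu> / L * (\<tau>\<^sup>2 / (1 + \<tau>)\<^sup>2)"
  have c_pos: "0 < c" using assms(4,8,11) by (simp add: c_def)
  have c_eq: "c = L / 2 * (K\<^sup>2 * (2 * \<mu>))"
    using assms(4,8) by (simp add: c_def K_def power_divide power_mult_distrib power2_eq_square ac_simps)
  have "q = inverse (1 + c)" unfolding c_def by (rule assms(14))
  then have q: "0 < q" "q < 1" "q * (1 + c) = 1"
    using c_pos by (simp_all add: inverse_less_1_iff)
  \<comment> \<open>The growth condition at the witness, the length of the step and the sufficient decrease chain up to
    \<open>c * e (Suc k) \<le> e k - e (Suc k)\<close>.\<close>
  have contract: "e (Suc k) \<le> q * e k" for k
  proof -
    define \<epsilon> where "\<epsilon> = f (p k) - f xs"
    have \<epsilon>: "0 \<le> \<epsilon>" "e (Suc k) \<le> \<epsilon>" using growth[OF p(3)] p(4) by (auto simp: \<epsilon>_def e_def)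
    have "K * (sqrt (2 * \<mu>) * sqrt \<epsilon>) \<le> n k"
      using growth[OF p(3)] K p(6) unfolding \<epsilon>_def by (meson less_imp_le mult_left_mono order_trans)
    then have "(K * (sqrt (2 * \<mu>) * sqrt \<epsilon>))\<^sup>2 \<le> (n k)\<^sup>2"
      using K \<epsilon>(1) assms(11) by (intro power_mono) auto
    then have "K\<^sup>2 * (2 * \<mu>) * \<epsilon> \<le> (n k)\<^sup>2"
      using \<epsilon>(1) assms(11) by (simp add: power_mult_distrib)
    then have "L / 2 * (K\<^sup>2 * (2 * \<mu>) * \<epsilon>) \<le> L / 2 * (n k)\<^sup>2"
      using assms(4) by (intro mult_left_mono) auto
    then have "c * \<epsilon> \<le> e k - e (Suc k)" using p(1)[of k] by (simp add: c_eq)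
    moreover have "c * e (Suc k) \<le> c * \<epsilon>" using \<epsilon>(2) c_pos by simp
    ultimately have "(1 + c) * e (Suc k) \<le> e k" by (simp add: algebra_simps)
    then have "q * ((1 + c) * e (Suc k)) \<le> q * e k" using q(1) by simp
    then show ?thesis using q(3) by (simp flip: mult.assoc)
  qed
  have rate: "e k \<le> q ^ k * e 0" for k
  proof (induction k)
    case (Suc k)
    then have "q * e k \<le> q * (q ^ k * e 0)" using q(1) by simp
    with contract[of k] show ?case by (simp add: mult.assoc)
  qed simp
  have "(\<lambda>k. q ^ k * e 0) \<longlonglongrightarrow> 0"
    using q by (intro tendsto_mult_left_zero LIMSEQ_power_zero) simp
  then have e_lim: "e \<longlonglongrightarrow> 0"
    by (rule tendsto_sandwich[OF _ _ tendsto_const, rotated 2]) (auto simp: e_nonneg rate)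
  have f_lim: "(\<lambda>k. f (x k)) \<longlonglongrightarrow> f xs"
    using LIM_zero_cancel[of "\<lambda>k. f (x k)"] e_lim unfolding e_def .

  \<comment> \<open>Bounding each \<open>e k - e (Suc k)\<close> by \<open>e k\<close> and summing a geometric series would lose the factor
    \<open>sqrt (1 - q)\<close>; telescoping \<open>sqrt (e k)\<close> keeps it.\<close>
  define C where "C = sqrt (2 / L) * (sqrt (1 - q) / (1 - sqrt q))"
  have C: "0 \<le> C" using q assms(4) by (simp add: C_def)
  have steps: "n k \<le> C * (sqrt (e k) - sqrt (e (Suc k)))" for k
  proof -
    have "(n k)\<^sup>2 \<le> 2 / L * (e k - e (Suc k))" using p(1)[of k] assms(4) by (simp add: field_simps)
    then have "n k \<le> sqrt (2 / L * (e k - e (Suc k)))"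
      by (rule real_le_rsqrt)
    also have "\<dots> = sqrt (2 / L) * sqrt (e k - e (Suc k))" by (rule real_sqrt_mult)
    also have "\<dots> \<le> sqrt (2 / L) * (sqrt (1 - q) / (1 - sqrt q) * (sqrt (e k) - sqrt (e (Suc k))))"
      using contract q e_nonneg assms(4) by (intro mult_left_mono sqrt_diff_le_diff_sqrt) auto
    finally show ?thesis by (simp add: C_def)
  qed
  have h_lim: "(\<lambda>k. sqrt (e k)) \<longlonglongrightarrow> 0" using tendsto_real_sqrt[OF e_lim] by simp
  obtain xt where xt: "x \<longlonglongrightarrow> xt" "\<And>k. norm (x k - xt) \<le> C * sqrt (e k)"
    by (rule converges_of_telescoping_steps[OF C _ _ h_lim, of x])
      (use steps e_nonneg in \<open>auto simp: n_def\<close>)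
  have "xt \<in> \<Omega>"
    using closed_sequentially[OF compact_imp_closed[OF assms(1)] _ xt(1)] \<Omega> by blast

  have "continuous_on \<Omega> f"
  proof (rule continuous_at_imp_continuous_on, rule)
    fix w assume "w \<in> \<Omega>"
    then have "GDERIV f w :> gradient f w" using assms(3) unfolding C1_on_def by blast
    then show "isCont f w" unfolding gderiv_def by (rule has_derivative_continuous)
  qed
  then have "(\<lambda>k. f (x k)) \<longlonglongrightarrow> f xt"
    using xt(1) \<open>xt \<in> \<Omega>\<close> \<Omega> by (intro continuous_on_tendsto_compose[of \<Omega> f]) auto
  then have f_xt: "f xt = f xs" using f_lim LIMSEQ_unique by blast

  have "(\<lambda>k. x (Suc k) - x k) \<longlonglongrightarrow> xt - xt"
    by (intro tendsto_diff xt(1) LIMSEQ_Suc)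
  then have n_lim: "n \<longlonglongrightarrow> 0" unfolding n_def using tendsto_norm_zero by fastforce
  have "(\<lambda>k. p k - x k) \<longlonglongrightarrow> 0"
    using p(5) by (intro Lim_null_comparison[OF _ n_lim]) simp
  from tendsto_add[OF this xt(1)] have p_lim: "p \<longlonglongrightarrow> xt" by simp
  have "(\<lambda>k. proj_norm \<Omega> (p k) (- gradient f (p k))) \<longlonglongrightarrow> 0"
  proof (rule Lim_null_comparison)
    show "(\<lambda>k. n k / K) \<longlonglongrightarrow> 0" using tendsto_divide_zero[OF n_lim] .
    show "\<forall>\<^sub>F k in sequentially. norm (proj_norm \<Omega> (p k) (- gradient f (p k))) \<le> n k / K"
      using p(6) K by (simp add: proj_norm_nonneg pos_le_divide_eq mult.commute)
  qed
  then have "stationary f \<Omega> xt"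
    using stationary_limit[OF assms(2) lipschitz_on_continuous_on[OF assms(5)] p(2) p_lim \<open>xt \<in> \<Omega>\<close>] by blast

  have "norm (x k - xt) \<le>
      sqrt (2 - 2 * q) * sqrt (f (x 0) - f xt) / (sqrt L * (1 - sqrt q)) * q powr (real k / 2)" for k
  proof -
    have "q powr (real k / 2) = sqrt (q ^ k)"
      using q(1) by (simp add: powr_half_sqrt_powr powr_realpow)
    moreover have "C = sqrt (2 - 2 * q) / (sqrt L * (1 - sqrt q))"
      using real_sqrt_mult[of 2 "1 - q"] by (simp add: C_def real_sqrt_divide algebra_simps)
    moreover have "norm (x k - xt) \<le> C * (sqrt (q ^ k) * sqrt (e 0))"
      using xt(2)[of k] mult_left_mono[OF real_sqrt_le_mono[OF rate[of k]] C]
      by (simp add: real_sqrt_mult)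
    ultimately show ?thesis by (simp add: e_def f_xt algebra_simps)
  qed
  with f_lim rate \<open>xt \<in> \<Omega>\<close> \<open>stationary f \<Omega> xt\<close> f_xt xt(1) show ?thesis
    unfolding e_def by blast
qed

end
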